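(* For every Godrèche--Lançon--Billard (GLB) tiling $\mathcal{T}$ of the plane, with vertex set $V(\mathcal{T})$, there exists a frieze pattern $f\colon V(\mathcal{T})\to\mathbb{Z}_{>0}$ on $\mathcal{T}$ that takes exactly three distinct values.
   Context: Rhombuses. All rhombuses have unit side length. The thick rhombus has interior angles $72^\circ$ and $108^\circ$; the thin rhombus has interior angles $36^\circ$ and $144^\circ$. A decorated tile is a rhombus in the plane $\mathbb{C}$ given with its vertices listed in cyclic order as $(m,t,o,s)$, where $m$ (the marked vertex) is a $72^\circ$ corner if the rhombus is thick and a $144^\circ$ corner if it is thin. So $o$ is opposite to $m$, and $t,s$ are the neighbours of $m$. (The vertex $t$ records an arrow along the edge from $t$ to $m$.) The cyclic order may be clockwise or counterclockwise. GLB substitution $\sigma$. Let $\lambda=2\cos(\pi/10)=\sqrt{(5+\sqrt5)/2}$. Given a decorated tile $(m,t,o,s)$, put $M=\lambda m$, $T=\lambda t$, $O=\lambda o$, $S=\lambda s$, and let $R$ be the rhombus with vertices $M,T,O,S$. For a side $XY$ of $R$ (of length $\lambda$), there are exactly two points at distance $1$ from both $X$ and $Y$; the inner apex of $XY$ is the one on the same side of the line $XY$ as $R$, and the outer apex is the other one. If the tile is thick, let $C$ be the inner apex of $MT$, $A$ the inner apex of $TO$, $E$ the outer apex of $MS$, $G$ the outer apex of $OS$, and $F=A+C-T$. Then $\sigma(m,t,o,s)$ consists of the three decorated thick tiles $(T,C,F,A)$, $(M,E,F,C)$, $(O,A,F,G)$ and the decorated thin tile $(S,G,F,E)$. If the tile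 is thin, let $w$ be the inner apex of $MT$ (which coincides with the inner apex of $TO$), $u$ the outer apex of $MS$, $v$ the outer apex of $OS$, and $x=u+v-S$. Then $\sigma(m,t,o,s)$ consists of the decorated thick tile $(S,v,x,u)$ and the two decorated thin tiles $(M,u,x,w)$, $(O,w,x,v)$. For a collection of decorated tiles, $\sigma$ is applied to every tile of the collection, and $\sigma^k$ denotes the $k$-fold iterate. GLB tilings. A GLB tiling is an edge-to-edge tiling of the plane by thick and thin rhombuses for which there is a decorated tile $P$ such that each finite patch of the tiling occurs, up to translation (and forgetting decorations), in $\sigma^k(P)$ for some $k\geq 1$. Frieze pattern. A frieze pattern on a tiling $\mathcal{T}$ by thick and thin rhombuses is a map $f$ from the set $V(\mathcal{T})$ of vertices of the tiles to the positive integers such that every tile satisfies the diamond rule $bc-ad=1$. Here $a,d$ are the values of $f$ at one pair of opposite vertices and $b,c$ are the values at the other pair, where: for a thick rhombus, $a,d$ are the values at the two $72^\circ$ corners and $b,c$ those at the two $108^\circ$ corners; for a thin rhombus, $a,d$ are the values at the two $144^\circ$ corners and $b,c$ those at the two $36^\circ$ corners. *)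

theory Defs
  imports "HOL-Analysis.Analysis"
begin

section \<open>Rhombuses and decorated tiles\<close>

text \<open>
  A decorated tile lists the vertices in cyclic order, starting with the marked one and in either
  orientation: \<open>(m, t, q, s)\<close>, with \<open>q\<close> opposite to \<open>m\<close>. (The letters \<open>o\<close> and \<open>O\<close> are infix
  symbols in HOL, so the vertex opposite to the mark is called \<open>q\<close>, and \<open>Q\<close> after scaling.)
\<close>

type_synonym dtile = "complex \<times> complex \<times> complex \<times> complex"

definition interior_angle :: "complex \<Rightarrow> complex \<Rightarrow> complex \<Rightarrow> real" where
  "interior_angle a p b = arccos (((a - p) \<bullet> (b - p)) / (dist a p * dist b p))"

fun unit_rhombus :: "dtile \<Rightarrow> bool" where
  "unit_rhombus (m, t, q, s) \<longleftrightarrow> dist m t = 1 \<and> dist m s = 1 \<and> t - m = q - s"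

fun thick :: "dtile \<Rightarrow> bool" where
  "thick (m, t, q, s) \<longleftrightarrow> unit_rhombus (m, t, q, s) \<and> interior_angle t m s = 72 * pi / 180"

fun thin :: "dtile \<Rightarrow> bool" where
  "thin (m, t, q, s) \<longleftrightarrow> unit_rhombus (m, t, q, s) \<and> interior_angle t m s = 144 * pi / 180"

fun region :: "dtile \<Rightarrow> complex set" where
  "region (m, t, q, s) = convex hull {m, t, q, s}"


section \<open>The substitution\<close>

definition infl :: real where
  "infl = 2 * cos (pi / 10)"

definition same_side :: "complex \<Rightarrow> complex \<Rightarrow> complex \<Rightarrow> complex \<Rightarrow> bool" where
  "same_side X Y z p \<longleftrightarrow> closed_segment z p \<inter> affine hull {X, Y} = {}"

text \<open>
  \<open>R\<close> is a rhombus with side \<open>XY\<close>. It meets only one of the two open sides of the line \<open>XY\<close>, and its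
  points on the line are on the same side as no point.
\<close>

definition inner_apex :: "complex set \<Rightarrow> complex \<Rightarrow> complex \<Rightarrow> complex" where
  "inner_apex R X Y =
     (THE z. dist z X = 1 \<and> dist z Y = 1 \<and> (\<exists>p\<in>R. same_side X Y z p))"

definition outer_apex :: "complex set \<Rightarrow> complex \<Rightarrow> complex \<Rightarrow> complex" where
  "outer_apex R X Y =
     (THE z. dist z X = 1 \<and> dist z Y = 1 \<and> \<not> (\<exists>p\<in>R. same_side X Y z p))"

fun scale_tile :: "real \<Rightarrow> dtile \<Rightarrow> dtile" where
  "scale_tile c (m, t, q, s) = (c *\<^sub>R m, c *\<^sub>R t, c *\<^sub>R q, c *\<^sub>R s)"

text \<open>The two functions below take the tile already scaled by \<^const>\<open>infl\<close>.\<close>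

fun subst_thick :: "dtile \<Rightarrow> dtile set" where
  "subst_thick (M, T, Q, S) =
    (let R = region (M, T, Q, S);
         C = inner_apex R M T;
         A = inner_apex R T Q;
         E = outer_apex R M S;
         G = outer_apex R Q S;
         F = A + C - T
     in {(T, C, F, A), (M, E, F, C), (Q, A, F, G), (S, G, F, E)})"

fun subst_thin :: "dtile \<Rightarrow> dtile set" where
  "subst_thin (M, T, Q, S) =
    (let R = region (M, T, Q, S);
         w = inner_apex R M T;
         u = outer_apex R M S;
         v = outer_apex R Q S;
         x = u + v - S
     in {(S, v, x, u), (M, u, x, w), (Q, w, x, v)})"

definition subst_tile :: "dtile \<Rightarrow> dtile set" where
  "subst_tile P =
    (if thick P then subst_thick (scale_tile infl P)
     else if thin P then subst_thin (scale_tile infl P)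
     else {})"

definition glb_subst :: "dtile set \<Rightarrow> dtile set" where
  "glb_subst \<P> = (\<Union>P\<in>\<P>. subst_tile P)"


section \<open>Tilings\<close>

text \<open>
  A tiling is a set of closed regions. Edge-to-edge means that two tiles meet in a common face
  (empty, a vertex, an edge) of both.
\<close>

definition rhombus_tiling :: "complex set set \<Rightarrow> bool" where
  "rhombus_tiling \<T> \<longleftrightarrow>
     (\<forall>R\<in>\<T>. \<exists>P. (thick P \<or> thin P) \<and> R = region P) \<and>
     \<Union>\<T> = UNIV \<and>
     (\<forall>R\<in>\<T>. \<forall>R'\<in>\<T>. R \<noteq> R' \<longrightarrow> interior R \<inter> interior R' = {})"

definition edge_to_edge :: "complex set set \<Rightarrow> bool" where
  "edge_to_edge \<T> \<longleftrightarrow>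
     (\<forall>R\<in>\<T>. \<forall>R'\<in>\<T>. R \<noteq> R' \<longrightarrow> (R \<inter> R') face_of R \<and> (R \<inter> R') face_of R')"

definition glb_tiling :: "complex set set \<Rightarrow> bool" where
  "glb_tiling \<T> \<longleftrightarrow>
     rhombus_tiling \<T> \<and> edge_to_edge \<T> \<and>
     (\<exists>P. (thick P \<or> thin P) \<and>
        (\<forall>\<Q>. \<Q> \<subseteq> \<T> \<and> finite \<Q> \<longrightarrow>
           (\<exists>k\<ge>1. \<exists>z. (\<lambda>R. (+) z ` R) ` \<Q> \<subseteq> region ` (glb_subst ^^ k) {P})))"

definition tiling_vertices :: "complex set set \<Rightarrow> complex set" where
  "tiling_vertices \<T> = (\<Union>R\<in>\<T>. {v. v extreme_point_of R})"


section \<open>Frieze patterns\<close>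

text \<open>
  Decorations serve only to name the corners here: \<open>m\<close> and \<open>q\<close> are the corners of \<open>72\<close> degrees of a
  thick rhombus and the corners of \<open>144\<close> degrees of a thin one, so the diamond rule has the same form
  for both. Values of \<open>f\<close> off the vertices are irrelevant.
\<close>

definition frieze_pattern :: "complex set set \<Rightarrow> (complex \<Rightarrow> int) \<Rightarrow> bool" where
  "frieze_pattern \<T> f \<longleftrightarrow>
     (\<forall>v\<in>tiling_vertices \<T>. f v > 0) \<and>
     (\<forall>m t q s. (thick (m, t, q, s) \<or> thin (m, t, q, s)) \<and> region (m, t, q, s) \<in> \<T> \<longrightarrow>
        f t * f s - f m * f q = 1)"

end

theory Submission
  imports Defs
begin

text \<open>
  Call the corners \<open>m\<close> and \<open>q\<close> of a tile black and the corners \<open>t\<close> and \<open>s\<close> white. The black angles are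
  multiples of 72 degrees and the white ones odd multiples of 36 degrees. The frieze pattern has the
  value 2 on white corners, and on the two black corners of each tile it has the values 1 and 3 in one
  of the two orders, so that the diamond rule reads \<open>2 * 2 - 1 * 3 = 1\<close>. What has to be shown is that
  these values fit together: a vertex is never black in one tile and white in another, and the values
  1 and 3 can be distributed consistently over the black vertices.

  Both follow from an invariant of the iterated substitution. In \<open>\<sigma>\<^sup>k(P)\<close> all decorated tiles are of the
  same orientation, which is reversed at each step, and for some unit \<open>u\<close> every edge that leaves a
  marked corner is \<open>u\<close> times a fifth root of unity (\<open>level_tile_iterate\<close>). Hence, from a common origin
  and in the unit \<open>u\<close>, every vertex is an integer combination of fifth roots of unity. Modulo 5 the
  sum of the coefficients is determined by the vertex (\<open>root_sum_unique\<close>), and it turns out to be 0 at \<open>m\<close>, 1 at \<open>t\<close>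
  and \<open>s\<close>, and 2 at \<open>q\<close>. The inductive step works because \<open>infl\<close> is a unit complex number times \<open>1 + h\<close>
  with \<open>h\<^sup>5 = -1\<close>: multiplication by \<open>infl\<close> turns all sums of coefficients into 0 (\<open>root_sum_scale\<close>), so
  all vertices of the inflated tiles are alike, and the new vertices are reached from them by one step
  or by two.

  A tile of the tiling comes without decoration, but its region determines the black pair and the white
  pair (\<open>golden_tile_region_eq\<close>). Any two tiles of the tiling occur together in a translate of some
  \<open>\<sigma>\<^sup>k(P)\<close> (\<open>glb_tiling_pair_indexed\<close>), and pairs are all that is needed: the index modulo 5 shows that
  black and white do not meet, and that the fifth power of the edges that leave a black vertex depends
  on the vertex only. These fifth powers are \<open>u\<^sup>5\<close> at the corners of index 0 and \<open>-u\<^sup>5\<close> at those of index 2, so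
  over the whole tiling they take two opposite values, one at each black corner of a tile. The values 1
  and 3 of the frieze pattern tell them apart.
\<close>

section \<open>Integer combinations of fifth roots of unity\<close>

text \<open>
  The integer is the sum of the coefficients. It is not determined by the complex number, since the
  five roots add up to 0, but its residue modulo 5 is.
\<close>

inductive root_sum :: "int \<Rightarrow> complex \<Rightarrow> bool" where
  zero: "root_sum 0 0"
| add: "root_sum c x \<Longrightarrow> y ^ 5 = 1 \<Longrightarrow> root_sum (c + 1) (x + y)"
| sub: "root_sum c x \<Longrightarrow> y ^ 5 = 1 \<Longrightarrow> root_sum (c - 1) (x - y)"

lemma root_sum_uminus: "root_sum c x \<Longrightarrow> root_sum (- c) (- x)"
proof (induction rule: root_sum.induct)
  case zero
  show ?case using root_sum.zero by simp
next
  case (add c x y)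
  have "root_sum (- c - 1) (- x - y)" using root_sum.sub[OF add.IH add.hyps(2)] .
  then show ?case by (simp add: minus_add_distrib)
next
  case (sub c x y)
  then show ?case using root_sum.add[OF sub.IH sub.hyps(2)] by (simp add: algebra_simps)
qed

lemma root_sum_plus: "root_sum c x \<Longrightarrow> root_sum d z \<Longrightarrow> root_sum (c + d) (x + z)"
proof (induction rule: root_sum.induct)
  case zero
  then show ?case by simp
next
  case (add c x y)
  then show ?case using root_sum.add[OF add.IH add.hyps(2)] by (simp add: algebra_simps)
next
  case (sub c x y)
  then show ?case using root_sum.sub[OF sub.IH sub.hyps(2)] by (simp add: algebra_simps)
qed

lemma root_sum_diff: "root_sum c x \<Longrightarrow> root_sum d z \<Longrightarrow> root_sum (c - d) (x - z)"
  using root_sum_plus[of c x "- d" "- z"] root_sum_uminus by simp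

lemma root_sum_root: "y ^ 5 = 1 \<Longrightarrow> root_sum 1 y"
  using root_sum.add[OF root_sum.zero] by simp

text \<open>
  Each root \<open>y\<close> becomes \<open>y - (- h * y)\<close>, a difference of two fifth roots of unity.
\<close>

lemma root_sum_scale:
  assumes "root_sum c x" "h ^ 5 = (- 1 :: complex)"
  shows "root_sum 0 ((1 + h) * x)"
  using assms(1)
proof (induction rule: root_sum.induct)
  case zero
  show ?case using root_sum.zero by simp
next
  case (add c x y)
  have "(- h * y) ^ 5 = 1" using add.hyps(2) assms(2) by (simp add: power_mult_distrib power_minus_odd)
  from root_sum.sub[OF root_sum.add[OF add.IH add.hyps(2)] this]
  show ?case by (simp add: algebra_simps)
next
  case (sub c x y)
  have "(- h * y) ^ 5 = 1" using sub.hyps(2) assms(2) by (simp add: power_mult_distrib power_minus_odd)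
  from root_sum.add[OF root_sum.sub[OF sub.IH sub.hyps(2)] this]
  show ?case by (simp add: algebra_simps)
qed

lemma norm_fifth_root: "y ^ 5 = 1 \<Longrightarrow> norm (y :: complex) = 1"
  by (metis norm_ge_zero norm_one norm_power power_eq_1_iff zero_neq_numeral)

lemma unit_cnj: "norm r = 1 \<Longrightarrow> r * cnj r = 1"
  by (simp add: complex_norm_square[symmetric])

text \<open>
  A root other than 1 satisfies \<open>1 + y + y\<^sup>2 + y\<^sup>3 + y\<^sup>4 = 0\<close>. Dividing by \<open>y\<^sup>2\<close> leaves a quadratic equation
  for \<open>y + 1 / y\<close>, which is twice the real part.
\<close>

lemma fifth_root_Re:
  assumes "y ^ 5 = (1 :: complex)" "y \<noteq> 1"
  shows "(2 * Re y)\<^sup>2 + 2 * Re y = 1"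
proof -
  have yc: "y * cnj y = 1" using unit_cnj norm_fifth_root assms(1) by blast
  have "(y - 1) * (1 + y + y^2 + y^3 + y^4) = 0"
    using assms(1) by (simp add: algebra_simps power_numeral_reduce)
  then have "1 + y + y^2 + y^3 + y^4 = 0" using assms(2) by simp
  then have "(cnj y)^2 * (1 + y + y^2 + y^3 + y^4) = 0" by simp
  then have "(y + cnj y)\<^sup>2 + (y + cnj y) = 1"
    using yc by algebra
  moreover have "y + cnj y = complex_of_real (2 * Re y)" by (simp add: complex_add_cnj)
  ultimately have "complex_of_real ((2 * Re y)\<^sup>2 + 2 * Re y) = complex_of_real 1"
    by (simp only: of_real_add of_real_power of_real_1)
  then show ?thesis by (simp only: of_real_eq_iff)
qed

text \<open>
  In lowest terms \<open>a / b\<close> the equation says \<open>a * (a + b) = b * b\<close>, which forces both \<open>a\<close> and \<open>b\<close> to be units.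
\<close>

lemma golden_irrational:
  fixes g :: real
  assumes "g\<^sup>2 + g = 1"
  shows "g \<notin> \<rat>"
proof
  assume "g \<in> \<rat>"
  then obtain a b :: int where ab: "b > 0" "coprime a b" "g = of_int a / of_int b"
    by (rule Rats_cases')
  then have "of_int a = g * of_int b" by simp
  then have "real_of_int (a * (a + b)) = (g\<^sup>2 + g) * real_of_int (b * b)"
    by (simp add: algebra_simps power2_eq_square)
  then have "real_of_int (a * (a + b)) = real_of_int (b * b)" using assms by simp
  then have eq: "a * (a + b) = b * b" by (simp only: of_int_eq_iff)
  then have "a dvd b * b" "b dvd a * a"
    by (metis dvd_triv_left, metis eq add.commute distrib_left dvd_add_left_iff dvd_triv_left dvd_triv_right)
  then have "is_unit a" "is_unit b"
    using ab(2) by (meson coprime_common_divisor coprime_dvd_mult_left_iff coprime_commute dvd_refl)+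
  then have "b = 1" "a = 1 \<or> a = - 1" using ab(1) by auto
  then show False using eq by auto
qed

text \<open>
  Real parts suffice. Twice the real part of a fifth root of unity is 2, \<open>g\<close> or \<open>- 1 - g\<close> for an
  irrational \<open>g\<close>, so twice the real part of a combination is \<open>p + r * g\<close> with integers \<open>p\<close> and \<open>r\<close>.
  The form \<open>p + 2 * r\<close> is congruent to 2 modulo 5 at each of the three values, hence to \<open>2 * c\<close> at a
  combination with coefficient sum \<open>c\<close>. Irrationality makes \<open>p\<close> and \<open>r\<close> vanish when the combination does.
\<close>

lemma root_sum_zero_dvd:
  assumes "root_sum c 0"
  shows "5 dvd c"
proof -
  define g :: real where "g = (sqrt 5 - 1) / 2"
  have g: "g\<^sup>2 + g = 1"
    by (simp add: g_def power2_eq_square field_simps)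
  have root: "\<exists>(p :: int) (r :: int). 2 * Re y = of_int p + of_int r * g \<and> 5 dvd (p + 2 * r - 2)" if "y ^ 5 = 1" for y :: complex
  proof (cases "y = 1")
    case True
    then show ?thesis by (intro exI[of _ 2] exI[of _ 0]) simp
  next
    case False
    have "(2 * Re y - g) * (2 * Re y + 1 + g) = 0"
      using fifth_root_Re[OF that False] g by (simp add: algebra_simps power2_eq_square)
    then consider "2 * Re y = 0 + 1 * g" | "2 * Re y = - 1 + (- 1) * g"
      by (simp only: mult_eq_0_iff) linarith
    then show ?thesis
    proof cases
      case 1
      then show ?thesis by (intro exI[of _ 0] exI[of _ 1]) simp
    next
      case 2
      then show ?thesis by (intro exI[of _ "-1"] exI[of _ "-1"]) simp
    qed
  qed
  have "root_sum c x \<Longrightarrow> \<exists>(p :: int) (r :: int). 2 * Re x = of_int p + of_int r * g \<and> 5 dvd (p + 2 * r - 2 * c)" for c x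
  proof (induction rule: root_sum.induct)
    case zero
    show ?case by (intro exI[of _ 0]) simp
  next
    case (add c x y)
    then obtain p r p' r' :: int where h: "2 * Re x = p + r * g" "5 dvd (p + 2 * r - 2 * c)"
      "2 * Re y = p' + r' * g" "5 dvd (p' + 2 * r' - 2)" using root by meson
    have "5 dvd (p + 2 * r - 2 * c) + (p' + 2 * r' - 2)" using h(2,4) by (rule dvd_add)
    then show ?case using h
      by (intro exI[of _ "p + p'"] exI[of _ "r + r'"]) (simp add: algebra_simps)
  next
    case (sub c x y)
    then obtain p r p' r' :: int where h: "2 * Re x = p + r * g" "5 dvd (p + 2 * r - 2 * c)"
      "2 * Re y = p' + r' * g" "5 dvd (p' + 2 * r' - 2)" using root by meson
    have "5 dvd (p + 2 * r - 2 * c) - (p' + 2 * r' - 2)" using h(2,4) by (rule dvd_diff)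
    then show ?case using h
      by (intro exI[of _ "p - p'"] exI[of _ "r - r'"]) (simp add: algebra_simps)
  qed
  from this[OF assms] obtain p r :: int
    where pr: "p + r * g = 0" "5 dvd (p + 2 * r - 2 * c)" by auto
  have "r = 0"
  proof (rule ccontr)
    assume "r \<noteq> 0"
    then have "g = - real_of_int p / real_of_int r"
      using pr(1) by (simp add: field_simps)
    then have "g \<in> \<rat>" by simp
    then show False using golden_irrational[OF g] by blast
  qed
  with pr have "5 dvd 2 * c" by simp
  then show ?thesis by presburger
qed

lemma root_sum_unique:
  assumes "root_sum i x" "root_sum j x"
  shows "5 dvd i - j"
  using root_sum_zero_dvd root_sum_diff[OF assms] by simp

section \<open>The two apexes of a side\<close>

text \<open>
  For a unit vector \<open>d\<close> this is the signed distance of \<open>z\<close> from the line through \<open>X\<close> in direction \<open>d\<close>,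
  positive on the left.
\<close>

definition line_side :: "complex \<Rightarrow> complex \<Rightarrow> complex \<Rightarrow> real" where
  "line_side X d z = Im ((z - X) * cnj d)"

lemma line_side_convex:
  "line_side X d ((1 - t) *\<^sub>R z + t *\<^sub>R p) = (1 - t) * line_side X d z + t * line_side X d p"
  by (simp add: line_side_def algebra_simps)

lemma on_line_iff:
  assumes "norm d = 1" "l \<noteq> 0"
  shows "z \<in> affine hull {X, X + of_real l * d} \<longleftrightarrow> line_side X d z = 0"
proof
  assume "z \<in> affine hull {X, X + of_real l * d}"
  then obtain t where "z = X + t *\<^sub>R (of_real l * d)"
    by (auto simp: affine_hull_2_alt)
  then have "(z - X) * cnj d = of_real (t * l) * (d * cnj d)"
    by (simp add: scaleR_conv_of_real)
  then show "line_side X d z = 0"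
    by (simp add: line_side_def unit_cnj assms)
next
  assume "line_side X d z = 0"
  then obtain t where t: "(z - X) * cnj d = of_real t"
    unfolding line_side_def by (metis complex_is_Real_iff Reals_cases)
  have "z - X = of_real t * d"
    using unit_cnj[OF assms(1)] t by algebra
  then have "z = X + (t / l) *\<^sub>R (X + of_real l * d - X)"
    using assms(2) by (simp add: scaleR_conv_of_real algebra_simps)
  then show "z \<in> affine hull {X, X + of_real l * d}"
    by (auto simp: affine_hull_2_alt)
qed

text \<open>
  The signed distance is affine along a segment, so the segment avoids the line exactly if the signed distances of
  its end points have the same strict sign.
\<close>

lemma same_side_iff:
  assumes "norm d = 1" "l \<noteq> 0"
  shows "same_side X (X + of_real l * d) z p \<longleftrightarrow> 0 < line_side X d z * line_side X d p"
proof -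
  let ?a = "line_side X d z" and ?b = "line_side X d p"
  have "same_side X (X + of_real l * d) z p \<longleftrightarrow> (\<forall>t\<in>{0..1}. (1 - t) * ?a + t * ?b \<noteq> 0)"
    unfolding same_side_def closed_segment_def
    using on_line_iff[OF assms, of _ X] line_side_convex[of X d _ z p] by fastforce
  also have "\<dots> \<longleftrightarrow> 0 < ?a * ?b"
  proof
    assume l: "\<forall>t\<in>{0..1}. (1 - t) * ?a + t * ?b \<noteq> 0"
    show "0 < ?a * ?b"
    proof (rule ccontr)
      assume "\<not> 0 < ?a * ?b"
      then have ab: "?a \<le> 0 \<and> 0 \<le> ?b \<or> 0 \<le> ?a \<and> ?b \<le> 0"
        by (simp add: zero_less_mult_iff) linarith
      have ne: "?a \<noteq> 0" using l[rule_format, of 0] by simp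
      \<comment> \<open>the zero of the affine function, which lies in the unit interval if the signs differ\<close>
      then have "?a / (?a - ?b) \<in> {0..1}" "?a - ?b \<noteq> 0"
        using ab by (auto simp: divide_simps)
      with l have "(1 - ?a / (?a - ?b)) * ?a + ?a / (?a - ?b) * ?b \<noteq> 0" by blast
      then show False using \<open>?a - ?b \<noteq> 0\<close> by (simp add: field_simps)
    qed
  next
    assume ab: "0 < ?a * ?b"
    show "\<forall>t\<in>{0..1}. (1 - t) * ?a + t * ?b \<noteq> 0"
    proof (intro ballI notI)
      fix t :: real
      assume t: "t \<in> {0..1}" and z: "(1 - t) * ?a + t * ?b = 0"
      have "?a * ((1 - t) * ?a + t * ?b) = (1 - t) * ?a\<^sup>2 + t * (?a * ?b)"
        by (simp add: algebra_simps power2_eq_square)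
      moreover have "(1 - t) * ?a\<^sup>2 \<ge> 0" "t * (?a * ?b) \<ge> 0" using t ab by auto
      moreover have "?a * ((1 - t) * ?a + t * ?b) = 0" using z by simp
      ultimately have "(1 - t) * ?a\<^sup>2 = 0" "t * (?a * ?b) = 0" by linarith+
      then show False using ab by auto
    qed
  qed
  finally show ?thesis .
qed

lemma infl_eq: "complex_of_real infl = cis (s * pi / 10) + cis (- (s * pi / 10))" if "s = 1 \<or> s = - 1"
  using that by (auto simp: infl_def complex_eq_iff)

lemma infl_pos: "0 < infl"
  unfolding infl_def by (intro mult_pos_pos cos_gt_zero_pi) (auto simp: field_simps)

text \<open>
  The triangle over a side of length \<open>infl = 2 * cos (pi / 10)\<close> with legs of length 1 has base angles of
  18 degrees. The sign \<open>s\<close> exchanges the two apexes; it serves to treat both orientations of a tile at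
  once.
\<close>

lemma apex_points:
  assumes d: "norm d = 1" and s: "s = 1 \<or> s = - 1"
  shows "dist z X = 1 \<and> dist z (X + of_real infl * d) = 1 \<longleftrightarrow>
    z = X + d * cis (s * pi / 10) \<or> z = X + d * cis (- (s * pi / 10))"
proof -
  define c where "c = cos (pi / 10)"
  \<comment> \<open>the coordinate of \<open>z\<close> with origin \<open>X\<close> and unit \<open>d\<close>\<close>
  define h where "h = (z - X) * cnj d"
  have c: "c > 0" using infl_pos by (simp add: infl_def c_def)
  have zd: "z - X = h * d" using unit_cnj[OF d] by (simp add: h_def ac_simps)
  have 1: "dist z X = norm h" using zd d by (simp add: dist_norm norm_mult)
  have "z - (X + of_real infl * d) = (h - of_real infl) * d"
    using zd by (simp add: algebra_simps)
  then have 2: "dist z (X + of_real infl * d) = norm (h - of_real infl)"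
    using d by (simp add: dist_norm norm_mult)
  have dne: "d \<noteq> 0" using d by auto
  have 3: "z = X + d * e \<longleftrightarrow> h = e" for e
    using zd dne by (metis add_diff_cancel_left' mult.commute mult_cancel_left add.commute diff_add_cancel)
  have "norm h = 1 \<and> norm (h - of_real infl) = 1 \<longleftrightarrow>
     (Re h)\<^sup>2 + (Im h)\<^sup>2 = 1 \<and> (Re h - 2 * c)\<^sup>2 + (Im h)\<^sup>2 = 1"
    by (simp add: cmod_def infl_def c_def)
  also have "\<dots> \<longleftrightarrow> Re h = c \<and> (Im h)\<^sup>2 = 1 - c\<^sup>2"
  proof -
    have "(Re h - 2 * c)\<^sup>2 = (Re h)\<^sup>2 \<longleftrightarrow> Re h = c"
      using c by (auto simp: power2_eq_iff)
    then show ?thesis by (smt (verit))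
  qed
  also have "\<dots> \<longleftrightarrow> Re h = c \<and> (Im h = sin (pi / 10) \<or> Im h = - sin (pi / 10))"
    unfolding c_def sin_squared_eq[of "pi / 10", symmetric] power2_eq_iff ..
  also have "\<dots> \<longleftrightarrow> h = cis (s * pi / 10) \<or> h = cis (- (s * pi / 10))"
    using s by (auto simp: complex_eq_iff c_def)
  finally show ?thesis by (simp only: 1 2 3)
qed

lemma line_side_nonneg_hull:
  assumes "\<forall>v\<in>V. 0 \<le> s * line_side X d v" "p \<in> convex hull V"
  shows "0 \<le> s * line_side X d p"
proof -
  have "convex {p. 0 \<le> s * line_side X d p}"
  proof (rule convexI)
    fix x y u v
    assume h: "x \<in> {p. 0 \<le> s * line_side X d p}" "y \<in> {p. 0 \<le> s * line_side X d p}"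
      "0 \<le> u" "0 \<le> v" "u + v = (1::real)"
    then have u: "u = 1 - v" by simp
    have "s * line_side X d (u *\<^sub>R x + v *\<^sub>R y) = u * (s * line_side X d x) + v * (s * line_side X d y)"
      unfolding u line_side_convex by (simp add: algebra_simps)
    then show "u *\<^sub>R x + v *\<^sub>R y \<in> {p. 0 \<le> s * line_side X d p}" using h by simp
  qed
  then have "convex hull V \<subseteq> {p. 0 \<le> s * line_side X d p}"
    using assms(1) by (intro hull_minimal) auto
  then show ?thesis using assms(2) by auto
qed

lemma sin_pi10: "sin (pi / 10) > 0"
  by (intro sin_gt_zero) auto

text \<open>
  If \<open>V\<close> lies weakly on one side of the line and not entirely on it, then its hull has a point on the
  same side as \<open>z\<close> exactly if \<open>z\<close> lies strictly on that side. This picks one of the two apexes as the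
  inner one, and the other, being off the line, is the outer one.
\<close>

lemma apexes:
  assumes d: "norm d = 1" and s: "s = 1 \<or> s = - 1"
    and V: "\<forall>v\<in>V. 0 \<le> s * line_side X d v" "\<exists>v\<in>V. 0 < s * line_side X d v"
    and Y: "Y = X + of_real infl * d"
  shows "inner_apex (convex hull V) X Y = X + d * cis (s * pi / 10)"
    and "outer_apex (convex hull V) X Y = X + d * cis (- (s * pi / 10))"
proof -
  let ?i = "X + d * cis (s * pi / 10)" and ?o = "X + d * cis (- (s * pi / 10))"
  have side: "line_side X d (X + d * e) = Im e" for e
  proof -
    have "d * e * cnj d = e" using unit_cnj[OF d] by algebra
    then show ?thesis by (simp only: line_side_def add_diff_cancel_left')
  qed
  have i: "0 < s * line_side X d ?i" and o: "s * line_side X d ?o < 0"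
    using s sin_pi10 by (auto simp only: side) auto
  have R: "(\<exists>p\<in>convex hull V. same_side X Y z p) \<longleftrightarrow> 0 < s * line_side X d z" for z
  proof -
    have "same_side X Y z p \<longleftrightarrow> 0 < line_side X d z * line_side X d p" for p
      unfolding Y using infl_pos by (intro same_side_iff d) simp
    moreover have "line_side X d z * line_side X d p = (s * line_side X d z) * (s * line_side X d p)" for p
      using s by auto
    ultimately have eq: "same_side X Y z p \<longleftrightarrow> 0 < (s * line_side X d z) * (s * line_side X d p)" for p
      by presburger
    show ?thesis unfolding eq
    proof
      assume "\<exists>p\<in>convex hull V. 0 < (s * line_side X d z) * (s * line_side X d p)"
      then obtain p where p: "p \<in> convex hull V" "0 < (s * line_side X d z) * (s * line_side X d p)" by blast
      then have "0 \<le> s * line_side X d p" using line_side_nonneg_hull[OF V(1)] by blast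
      with p(2) show "0 < s * line_side X d z"
        by (meson mult_nonpos_nonneg not_less)
    next
      assume z: "0 < s * line_side X d z"
      from V(2) obtain v where "v \<in> V" "0 < s * line_side X d v" by blast
      then show "\<exists>p\<in>convex hull V. 0 < (s * line_side X d z) * (s * line_side X d p)"
        using z by (meson hull_inc mult_pos_pos)
    qed
  qed
  have P: "dist z X = 1 \<and> dist z Y = 1 \<longleftrightarrow> z = ?i \<or> z = ?o" for z
    unfolding Y by (rule apex_points[OF d s])
  show "inner_apex (convex hull V) X Y = ?i"
    unfolding inner_apex_def R by (intro the_equality) (metis P i o less_asym)+
  show "outer_apex (convex hull V) X Y = ?o"
    unfolding outer_apex_def R by (intro the_equality) (metis P i o less_asym)+
qed

section \<open>Golden rhombuses in coordinates\<close>

definition rhombus_at :: "complex \<Rightarrow> complex \<Rightarrow> complex \<Rightarrow> dtile" where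
  "rhombus_at m a r = (m, m + a, m + a + a * r, m + a * r)"

text \<open>
  Thick and thin tiles at once: the quotient of the two edges at the mark is a nontrivial fifth root of
  unity, that is, the angle there is 72 or 144 degrees, in either orientation.
\<close>

definition golden_tile :: "dtile \<Rightarrow> bool" where
  "golden_tile P \<longleftrightarrow> (\<exists>m a r. P = rhombus_at m a r \<and> norm a = 1 \<and> r ^ 5 = 1 \<and> r \<noteq> 1)"

lemma cis_of_Re:
  assumes "norm r = 1" "Re r = cos \<theta>"
  shows "r = cis \<theta> \<or> r = cis (- \<theta>)"
proof -
  have "(Im r)\<^sup>2 = (sin \<theta>)\<^sup>2"
    using assms cmod_power2[of r] sin_squared_eq[of \<theta>] by simp
  then show ?thesis using assms(2) by (auto simp: power2_eq_iff complex_eq_iff)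
qed

lemma unit_rhombus_form:
  assumes "unit_rhombus (m, t, q, s)" "interior_angle t m s = \<theta>"
  obtains a r where "(m, t, q, s) = rhombus_at m a r" "norm a = 1" "norm r = 1" "Re r = cos \<theta>"
proof
  let ?a = "t - m" and ?b = "s - m"
  have na: "norm ?a = 1" and nb: "norm ?b = 1"
    using assms(1) by (metis unit_rhombus.simps dist_norm dist_commute)+
  have q: "q = t + s - m" using assms(1) by (simp add: algebra_simps)
  have ar: "?a * (?b * cnj ?a) = ?b" using unit_cnj[OF na] by algebra
  show "(m, t, q, s) = rhombus_at m ?a (?b * cnj ?a)"
    unfolding rhombus_at_def ar using q by simp
  show "norm ?a = 1" by (rule na)
  show "norm (?b * cnj ?a) = 1" using na nb by (simp only: norm_mult complex_mod_cnj mult_1)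
  have "\<bar>?a \<bullet> ?b\<bar> \<le> 1" using Cauchy_Schwarz_ineq2[of ?a ?b] na nb by simp
  then have "cos \<theta> = ?a \<bullet> ?b"
    using assms na nb by (auto simp: interior_angle_def dist_norm intro!: cos_arccos_abs)
  then show "Re (?b * cnj ?a) = cos \<theta>" by (simp add: inner_complex_def algebra_simps)
qed

lemma thick_form:
  assumes "thick (m, t, q, s)"
  obtains a r where "(m, t, q, s) = rhombus_at m a r" "norm a = 1" "norm r = 1" "Re r = cos (2 * pi / 5)"
  using unit_rhombus_form[of m t q s "72 * pi / 180"] assms by auto

lemma thin_form:
  assumes "thin (m, t, q, s)"
  obtains a r where "(m, t, q, s) = rhombus_at m a r" "norm a = 1" "norm r = 1" "Re r = cos (4 * pi / 5)"
  using unit_rhombus_form[of m t q s "144 * pi / 180"] assms by auto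

lemma rhombus_at_inj: "rhombus_at m a r = rhombus_at m' a' r' \<longleftrightarrow> m = m' \<and> a = a' \<and> (a = 0 \<or> r = r')"
  by (auto simp: rhombus_at_def)

lemma thick_Re: "thick (rhombus_at m a r) \<Longrightarrow> norm a = 1 \<Longrightarrow> Re r = cos (2 * pi / 5)"
proof -
  assume h: "thick (rhombus_at m a r)" "norm a = 1"
  obtain a' r' where "rhombus_at m a r = rhombus_at m a' r'" "Re r' = cos (2 * pi / 5)"
    using thick_form[OF h(1)[unfolded rhombus_at_def]] unfolding rhombus_at_def by metis
  then show ?thesis using h(2) by (auto simp: rhombus_at_inj)
qed

lemma thin_Re: "thin (rhombus_at m a r) \<Longrightarrow> norm a = 1 \<Longrightarrow> Re r = cos (4 * pi / 5)"
proof -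
  assume h: "thin (rhombus_at m a r)" "norm a = 1"
  obtain a' r' where "rhombus_at m a r = rhombus_at m a' r'" "Re r' = cos (4 * pi / 5)"
    using thin_form[OF h(1)[unfolded rhombus_at_def]] unfolding rhombus_at_def by metis
  then show ?thesis using h(2) by (auto simp: rhombus_at_inj)
qed

section \<open>Recovering the corners from the region\<close>

text \<open>
  The other corners lie in a half plane that is orthogonal to the diagonal \<open>a + b\<close> and excludes \<open>m\<close>.
\<close>

lemma rhombus_corner_extreme:
  fixes m a b :: "'a :: euclidean_space"
  assumes "norm a = 1" "norm b = 1" "a \<noteq> - b"
  shows "m extreme_point_of (convex hull {m, m + a, m + a + b, m + b})"
proof (rule extreme_point_of_convex_hull_insert)
  have "a + b \<noteq> 0" using assms(3) by (simp add: eq_neg_iff_add_eq_0)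
  then have "0 < (a + b) \<bullet> (a + b)" by simp
  moreover have "a \<bullet> a = 1" "b \<bullet> b = 1" using assms by (auto simp: dot_square_norm)
  ultimately have pos: "0 < 1 + a \<bullet> b" by (simp add: inner_simps inner_commute)
  have "convex hull {m + a, m + a + b, m + b} \<subseteq> {x. (a + b) \<bullet> x \<ge> (a + b) \<bullet> m + (1 + a \<bullet> b)}"
    using pos \<open>a \<bullet> a = 1\<close> \<open>b \<bullet> b = 1\<close>
    by (intro hull_minimal convex_halfspace_ge) (auto simp: inner_simps inner_commute)
  then show "m \<notin> convex hull {m + a, m + a + b, m + b}" using pos by force
qed simp

lemma rhombus_extreme_points:
  fixes m a b :: "'a :: euclidean_space"
  assumes "norm a = 1" "norm b = 1" "a \<noteq> b" "a \<noteq> - b"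
  shows "{v. v extreme_point_of (convex hull {m, m + a, m + a + b, m + b})} = {m, m + a, m + a + b, m + b}"
    (is "?E = ?V")
proof
  show "?E \<subseteq> ?V" using extreme_point_of_convex_hull by blast
  have "m extreme_point_of (convex hull ?V)"
    using rhombus_corner_extreme[of a b m] assms by simp
  moreover have "(m + a) extreme_point_of (convex hull ?V)"
    using rhombus_corner_extreme[of "- a" b "m + a"] assms
    by (simp add: insert_commute add.commute add.left_commute)
  moreover have "(m + a + b) extreme_point_of (convex hull ?V)"
    using rhombus_corner_extreme[of "- a" "- b" "m + a + b"] assms
    by (simp add: insert_commute minus_equation_iff[of a] algebra_simps)
  moreover have "(m + b) extreme_point_of (convex hull ?V)"
    using rhombus_corner_extreme[of a "- b" "m + b"] assms
    by (simp add: insert_commute algebra_simps)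
  ultimately show "?V \<subseteq> ?E" by auto
qed

text \<open>
  With \<open>D\<close> for the square of the distance: \<open>D\<^sup>2 - 3 * D + 1\<close> vanishes at the diagonal \<open>mq\<close> of both
  shapes (the golden ratio for the thick one, its
  inverse for the thin one), and not at an edge or at the other diagonal.
\<close>

definition black_distance :: "complex \<Rightarrow> complex \<Rightarrow> bool" where
  "black_distance x y \<longleftrightarrow> ((dist x y)\<^sup>2)\<^sup>2 - 3 * (dist x y)\<^sup>2 + 1 = 0"

definition black_corners :: "complex set \<Rightarrow> complex set" where
  "black_corners R = {x. x extreme_point_of R \<and> (\<exists>y. y extreme_point_of R \<and> black_distance x y)}"

text \<open>
  Let \<open>h' = 2 * Re r\<close>, so \<open>h'\<^sup>2 + h' = 1\<close>. The squares of the diagonals are \<open>2 + h'\<close> and \<open>2 - h'\<close>; the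
  first is a root of \<open>D\<^sup>2 - 3 * D + 1\<close>, and the second is not, as this would force \<open>h' = 0\<close>. This singles out the black corners by
  distances between extreme points, without reference to the decoration.
\<close>

lemma golden_tile_corners:
  assumes "golden_tile (m, t, q, s)"
  shows "{v. v extreme_point_of region (m, t, q, s)} = {m, t, q, s}"
    and "black_corners (region (m, t, q, s)) = {m, q}"
    and "m \<notin> {t, s}" "q \<notin> {t, s}"
proof -
  obtain a r where h: "t = m + a" "q = m + a + a * r" "s = m + a * r" "norm a = 1" "r ^ 5 = 1" "r \<noteq> 1"
    using assms unfolding golden_tile_def rhombus_at_def by auto
  have nr: "norm r = 1" by (rule norm_fifth_root[OF h(5)])
  have a0: "a \<noteq> 0" using h(4) by auto
  have "r \<noteq> - 1" using h(5) by auto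
  have 1: "norm (a * r) = 1" "a \<noteq> a * r" "a \<noteq> - (a * r)"
    using nr h(4,6) a0 \<open>r \<noteq> -1\<close> by (auto simp: norm_mult) (metis mult_cancel_left2 mult_minus_right minus_equation_iff)
  show ext: "{v. v extreme_point_of region (m, t, q, s)} = {m, t, q, s}"
    using rhombus_extreme_points[OF h(4) 1, of m] unfolding h(1-3) by simp
  define h' where "h' = 2 * Re r"
  have h': "h'\<^sup>2 + h' = 1" unfolding h'_def by (rule fifth_root_Re[OF h(5,6)])
  have nr2: "(Re r)\<^sup>2 + (Im r)\<^sup>2 = 1" using nr by (simp add: cmod_def)
  have "(norm (a + a * r))\<^sup>2 = (norm a)\<^sup>2 * (norm (1 + r))\<^sup>2" by (simp add: norm_mult[symmetric] power_mult_distrib[symmetric] algebra_simps)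
  also have "\<dots> = 2 + h'" unfolding h'_def h(4) cmod_power2 using nr2 by (simp add: power2_eq_square algebra_simps)
  finally have mq: "(norm (a + a * r))\<^sup>2 = 2 + h'" .
  have "(norm (a - a * r))\<^sup>2 = (norm a)\<^sup>2 * (norm (1 - r))\<^sup>2" by (simp add: norm_mult[symmetric] power_mult_distrib[symmetric] algebra_simps)
  also have "\<dots> = 2 - h'" unfolding h'_def h(4) cmod_power2 using nr2 by (simp add: power2_eq_square algebra_simps)
  finally have ts: "(norm (a - a * r))\<^sup>2 = 2 - h'" .
  have d1: "dist m q = norm (a + a * r)" "dist t s = norm (a - a * r)"
    unfolding dist_commute[of m] using h(1-3) by (simp_all add: dist_norm algebra_simps)
  have d2: "dist m t = 1" "dist m s = 1" "dist q t = 1" "dist q s = 1"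
    using h 1(1) by (simp_all add: dist_norm)
  have b1: "black_distance m q"
    unfolding black_distance_def d1 mq using h' by (simp add: power2_eq_square algebra_simps)
  have w1: "\<not> black_distance t s"
    unfolding black_distance_def d1 ts
  proof
    assume "(2 - h')\<^sup>2 - 3 * (2 - h') + 1 = 0"
    then have "h' = 0" using h' by (simp add: power2_eq_square algebra_simps)
    then show False using h' by simp
  qed
  have b2: "black_distance q m" using b1 by (simp add: black_distance_def dist_commute)
  have w2: "\<not> black_distance s t" using w1 by (simp add: black_distance_def dist_commute)
  have w3: "\<not> black_distance x x" for x by (simp add: black_distance_def)
  have e: "\<not> black_distance t m" "\<not> black_distance t q" "\<not> black_distance s m" "\<not> black_distance s q"
    using d2 by (auto simp: black_distance_def dist_commute)
  have "v extreme_point_of region (m, t, q, s) \<longleftrightarrow> v \<in> {m, t, q, s}" for v using ext by blast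
  then show "black_corners (region (m, t, q, s)) = {m, q}"
    unfolding black_corners_def using b1 b2 w1 w2 w3 e by auto
  show "m \<notin> {t, s}" "q \<notin> {t, s}" using d2 by auto
qed

lemma golden_tile_region_eq:
  assumes "golden_tile (m, t, q, s)" "golden_tile (m', t', q', s')"
    "region (m, t, q, s) = region (m', t', q', s')"
  shows "m = m' \<and> q = q' \<or> m = q' \<and> q = m'" "t = t' \<and> s = s' \<or> t = s' \<and> s = t'"
proof -
  note c = golden_tile_corners[OF assms(1)] and c' = golden_tile_corners[OF assms(2)]
  have mq: "{m, q} = {m', q'}" by (rule trans[OF sym[OF c(2)[unfolded assms(3)]] c'(2)])
  have V: "{m, t, q, s} = {m', t', q', s'}" by (rule trans[OF sym[OF c(1)[unfolded assms(3)]] c'(1)])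
  have ts: "{t, s} = {m, t, q, s} - {m, q}" "{t', s'} = {m', t', q', s'} - {m', q'}"
    using c(3,4) c'(3,4) by auto
  have "{t, s} = {t', s'}" unfolding ts V mq ..
  with mq show "m = m' \<and> q = q' \<or> m = q' \<and> q = m'" "t = t' \<and> s = s' \<or> t = s' \<and> s = t'"
    unfolding doubleton_eq_iff by blast+
qed

lemma golden_tile_flip:
  assumes "golden_tile (m, t, q, s)"
  shows "golden_tile (q, s, m, t)" "golden_tile (m, s, q, t)"
proof -
  obtain a r where h: "t = m + a" "q = m + a + a * r" "s = m + a * r" "norm a = 1" "r ^ 5 = 1" "r \<noteq> 1"
    using assms unfolding golden_tile_def rhombus_at_def by auto
  have nr: "norm r = 1" by (rule norm_fifth_root[OF h(5)])
  then have r0: "r \<noteq> 0" by auto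
  have "(q, s, m, t) = rhombus_at q (- a) r" using h by (simp add: rhombus_at_def)
  then show "golden_tile (q, s, m, t)" unfolding golden_tile_def using h(4-6) norm_minus_cancel by metis
  have "(m, s, q, t) = rhombus_at m (a * r) (inverse r)" using h r0 by (simp add: rhombus_at_def)
  moreover have "norm (a * r) = 1" "inverse r ^ 5 = 1" "inverse r \<noteq> 1"
    using h(4-6) nr by (auto simp: norm_mult power_inverse)
  ultimately show "golden_tile (m, s, q, t)" unfolding golden_tile_def by blast
qed

lemma region_flip:
  "region (q, s, m, t) = region (m, t, q, s)" "region (m, s, q, t) = region (m, t, q, s)"
  by (simp_all add: insert_commute)

lemma golden_tile_translate:
  assumes "golden_tile (m, t, q, s)"
  shows "golden_tile (z + m, z + t, z + q, z + s)"
    and "region (z + m, z + t, z + q, z + s) = (+) z ` region (m, t, q, s)"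
proof -
  obtain a r where h: "(m, t, q, s) = rhombus_at m a r" "norm a = 1" "r ^ 5 = 1" "r \<noteq> 1"
    using assms unfolding golden_tile_def rhombus_at_def by auto
  then have "(z + m, z + t, z + q, z + s) = rhombus_at (z + m) a r" by (simp add: rhombus_at_def algebra_simps)
  with h(2-4) show "golden_tile (z + m, z + t, z + q, z + s)" unfolding golden_tile_def by blast
  show "region (z + m, z + t, z + q, z + s) = (+) z ` region (m, t, q, s)"
    using convex_hull_translation[of z "{m, t, q, s}"] by simp
qed

section \<open>The substitution in coordinates\<close>

lemma cis_pow10: "s = 1 \<or> s = - 1 \<Longrightarrow> cis (s * pi / 10) ^ 10 = - 1"
  by (auto simp: Complex.DeMoivre complex_eq_iff)

text \<open>
  The four apexes that the substitution uses. The sign \<open>s\<close> is the orientation of the tile: the region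
  is on the left of \<open>MT\<close>, \<open>TQ\<close> and \<open>QS\<close>, and on the right of \<open>MS\<close>, if \<open>s = 1\<close>, and the other way round if \<open>s = - 1\<close>.
\<close>

lemma rhombus_apexes:
  fixes M a r :: complex
  assumes a: "norm a = 1" and r: "norm r = 1" "0 < s * Im r" and s: "s = 1 \<or> s = - 1"
  defines "b \<equiv> of_real infl * a" and "e \<equiv> cis (s * pi / 10)"
  defines "R \<equiv> region (rhombus_at M b r)"
  shows "inner_apex R M (M + b) = M + a * e"
    and "inner_apex R (M + b) (M + b + b * r) = M + b + a * r * e"
    and "outer_apex R M (M + b * r) = M + a * r * e"
    and "outer_apex R (M + b + b * r) (M + b * r) = M + b * r + a * e"
proof -
  let ?V = "{M, M + b, M + b + b * r, M + b * r}"
  have R: "R = convex hull ?V" by (simp add: R_def rhombus_at_def)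
  have ac: "a * cnj a = 1" and rc: "r * cnj r = 1" using unit_cnj a r by auto
  have nar: "norm (a * r) = 1" using a r by (simp add: norm_mult)
  have s': "- s = 1 \<or> - s = - 1" using s by auto
  have side_a: "line_side X a (X + b * z) = infl * Im z" for X z
  proof -
    have "b * z * cnj a = of_real infl * z" unfolding b_def using ac by algebra
    then show ?thesis by (simp only: line_side_def add_diff_cancel_left') simp
  qed
  have side_ar: "line_side X (a * r) (X + b * z) = infl * Im (z * cnj r)" for X z
  proof -
    have "b * z * cnj (a * r) = of_real infl * (z * cnj r)" unfolding b_def complex_cnj_mult using ac by algebra
    then show ?thesis by (simp only: line_side_def add_diff_cancel_left') simp
  qed
  have kr: "0 < s * (infl * Im r)"
    using mult_pos_pos[OF infl_pos r(2)] by (simp add: ac_simps)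
  have lam: "of_real infl = e + cis (- (s * pi / 10))" unfolding e_def by (rule infl_eq[OF s])
  {
    have "line_side M a M = 0" "line_side M a (M + b) = 0"
      "line_side M a (M + b + b * r) = infl * Im r" "line_side M a (M + b * r) = infl * Im r"
      using side_a[of M 0] side_a[of M 1] side_a[of M "1 + r"] side_a[of M r]
      by (simp_all add: algebra_simps)
    then have "\<forall>v\<in>?V. 0 \<le> s * line_side M a v" "\<exists>v\<in>?V. 0 < s * line_side M a v"
      using kr by (auto simp: less_imp_le)
    from apexes(1)[OF a s this] show "inner_apex R M (M + b) = M + a * e"
      unfolding R e_def b_def by blast
  }
  {
    let ?X = "M + b"
    have "line_side ?X (a * r) M = infl * Im r" "line_side ?X (a * r) (M + b) = 0"
      "line_side ?X (a * r) (M + b + b * r) = 0" "line_side ?X (a * r) (M + b * r) = infl * Im r"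
      using side_ar[of ?X "-1"] side_ar[of ?X 0] side_ar[of ?X "r"] side_ar[of ?X "r - 1"] rc
      by (simp_all add: algebra_simps)
    then have "\<forall>v\<in>?V. 0 \<le> s * line_side ?X (a * r) v" "\<exists>v\<in>?V. 0 < s * line_side ?X (a * r) v"
      using kr by (auto simp: less_imp_le)
    from apexes(1)[OF nar s this] show "inner_apex R (M + b) (M + b + b * r) = M + b + a * r * e"
      unfolding R e_def b_def by (simp only: mult.assoc)
  }
  {
    have "line_side M (a * r) M = 0" "line_side M (a * r) (M + b) = - infl * Im r"
      "line_side M (a * r) (M + b + b * r) = - infl * Im r" "line_side M (a * r) (M + b * r) = 0"
      using side_ar[of M "0"] side_ar[of M 1] side_ar[of M "1 + r"] side_ar[of M "r"] rc
      by (simp_all add: algebra_simps)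
    then have "\<forall>v\<in>?V. 0 \<le> - s * line_side M (a * r) v" "\<exists>v\<in>?V. 0 < - s * line_side M (a * r) v"
      using kr by (auto simp: less_imp_le)
    from apexes(2)[OF nar s' this] show "outer_apex R M (M + b * r) = M + a * r * e"
      unfolding R e_def b_def by (simp add: mult.assoc)
  }
  {
    let ?X = "M + b + b * r"
    have na: "norm (- a) = 1" using a by simp
    have neg: "line_side X (- a) v = - line_side X a v" for X v by (simp add: line_side_def)
    have "line_side ?X (- a) M = infl * Im r" "line_side ?X (- a) (M + b) = infl * Im r"
      "line_side ?X (- a) (M + b + b * r) = 0" "line_side ?X (- a) (M + b * r) = 0"
      using side_a[of ?X "- 1 - r"] side_a[of ?X "- r"] side_a[of ?X "0"] side_a[of ?X "-1"]
      unfolding neg by (simp_all add: algebra_simps)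
    then have "\<forall>v\<in>?V. 0 \<le> s * line_side ?X (- a) v" "\<exists>v\<in>?V. 0 < s * line_side ?X (- a) v"
      using kr by (auto simp: less_imp_le)
    moreover have "M + b * r = ?X + of_real infl * (- a)" by (simp add: b_def)
    ultimately have "outer_apex R ?X (M + b * r) = ?X + - a * cis (- (s * pi / 10))"
      using apexes(2)[OF na s] unfolding R by blast
    also have "\<dots> = M + b * r + a * e"
      unfolding b_def lam by (simp add: algebra_simps)
    finally show "outer_apex R ?X (M + b * r) = M + b * r + a * e" .
  }
qed

text \<open>
  With \<open>e\<close> the rotation by 18 degrees in the sense of the orientation of the tile, the quotient of the edges at the
  mark is \<open>e ^ 4\<close> for a thick tile and \<open>e ^ 8\<close> for a thin one. The new tiles have \<open>f = 1 / e\<close> in the place of \<open>e\<close>,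
  that is, the opposite orientation. The first edge of each new tile is \<open>a * e\<close> times a fifth root of unity.
  Once the apexes are known, what remains are polynomial identities modulo \<open>e ^ 10 = - 1\<close>.
\<close>

lemma subst_explicit:
  fixes m a :: complex
  assumes a: "norm a = 1" and s: "s = 1 \<or> s = - 1"
  defines "e \<equiv> cis (s * pi / 10)" and "l \<equiv> complex_of_real infl" and "f \<equiv> cis (- s * pi / 10)"
  shows "subst_thick (rhombus_at (l * m) (l * a) (e ^ 4)) =
    {rhombus_at (l * (m + a)) (a * e * e ^ 8) (f ^ 4), rhombus_at (l * m) (a * e * e ^ 4) (f ^ 4),
     rhombus_at (l * (m + a + a * e ^ 4)) (a * e * (- (e ^ 2))) (f ^ 4),
     rhombus_at (l * (m + a * e ^ 4)) (a * e) (f ^ 8)}"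
    and "subst_thin (rhombus_at (l * m) (l * a) (e ^ 8)) =
    {rhombus_at (l * (m + a * e ^ 8)) (a * e) (f ^ 4), rhombus_at (l * m) (a * e * e ^ 8) (f ^ 8),
     rhombus_at (l * (m + a + a * e ^ 8)) (a * e * (- (e ^ 6))) (f ^ 8)}"
proof -
  have e10: "e ^ 10 = - 1" unfolding e_def by (rule cis_pow10[OF s])
  have "e * f = 1" by (simp add: e_def f_def cis_mult)
  then have f: "f = - (e ^ 9)" using e10 by algebra
  have f4: "f ^ 4 = - (e ^ 6)" and f8: "f ^ 8 = - (e ^ 2)" unfolding f using e10 by algebra+
  have l: "l = e - e ^ 9" using infl_eq[OF s] f by (simp add: l_def e_def f_def)
  have ne: "norm e = 1" by (simp add: e_def)
  have s4: "0 < s * Im (e ^ 4)" and s8: "0 < s * Im (e ^ 8)"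
    using s sin_gt_zero[of "2 * pi / 5"] sin_gt_zero[of "4 * pi / 5"] by (auto simp: e_def Complex.DeMoivre)
  have n4: "norm (e ^ 4) = 1" and n8: "norm (e ^ 8) = 1" using ne by (simp_all add: norm_power)
  note ap4 = rhombus_apexes[OF a n4 s4 s, of "l * m", folded e_def l_def, unfolded rhombus_at_def]
  note ap8 = rhombus_apexes[OF a n8 s8 s, of "l * m", folded e_def l_def, unfolded rhombus_at_def]
  show "subst_thick (rhombus_at (l * m) (l * a) (e ^ 4)) =
    {rhombus_at (l * (m + a)) (a * e * e ^ 8) (f ^ 4), rhombus_at (l * m) (a * e * e ^ 4) (f ^ 4),
     rhombus_at (l * (m + a + a * e ^ 4)) (a * e * (- (e ^ 2))) (f ^ 4),
     rhombus_at (l * (m + a * e ^ 4)) (a * e) (f ^ 8)}"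
    unfolding rhombus_at_def subst_thick.simps Let_def ap4
    unfolding f4 f8 l using e10 by (intro arg_cong2[where f=insert] arg_cong2[where f=Pair] refl;
      (algebra | simp add: algebra_simps power_numeral_reduce))
  show "subst_thin (rhombus_at (l * m) (l * a) (e ^ 8)) =
    {rhombus_at (l * (m + a * e ^ 8)) (a * e) (f ^ 4), rhombus_at (l * m) (a * e * e ^ 8) (f ^ 8),
     rhombus_at (l * (m + a + a * e ^ 8)) (a * e * (- (e ^ 6))) (f ^ 8)}"
    unfolding rhombus_at_def subst_thin.simps Let_def ap8
    unfolding f4 f8 l using e10 by (intro arg_cong2[where f=insert] arg_cong2[where f=Pair] refl;
      (algebra | simp add: algebra_simps power_numeral_reduce))
qed

section \<open>An invariant of the iterated substitution\<close>

text \<open>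
  The property that all tiles of one level of the substitution share, with the same \<open>s\<close>, \<open>c\<close> and \<open>u\<close>:
  orientation \<open>s\<close>, edges at the mark equal to \<open>u\<close> times a fifth root of unity, and marks of index 0 with
  respect to the origin \<open>c\<close> and the unit \<open>u\<close>.
\<close>

definition level_tile :: "real \<Rightarrow> complex \<Rightarrow> complex \<Rightarrow> dtile \<Rightarrow> bool" where
  "level_tile s c u P \<longleftrightarrow> (\<exists>m a r. P = rhombus_at m a r \<and> (r = cis (s * pi / 10) ^ 4 \<or> r = cis (s * pi / 10) ^ 8) \<and>
     (a / u) ^ 5 = 1 \<and> root_sum 0 ((m - c) / u))"

lemma level_tile_start:
  assumes "thick P \<or> thin P"
  obtains s c u where "s = 1 \<or> s = - 1" "norm u = 1" "level_tile s c u P"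
proof -
  obtain m t q s where P: "P = (m, t, q, s)" by (metis prod_cases4)
  have "\<exists>\<theta> a r. (\<theta> = 2 * pi / 5 \<or> \<theta> = 4 * pi / 5) \<and> P = rhombus_at m a r \<and> norm a = 1 \<and> norm r = 1 \<and> Re r = cos \<theta>"
  proof (cases "thick P")
    case True
    then show ?thesis unfolding P by (rule thick_form) blast
  next
    case False
    then have "thin P" using assms by simp
    then show ?thesis unfolding P by (rule thin_form) blast
  qed
  then obtain \<theta> a r where th: "\<theta> = 2 * pi / 5 \<or> \<theta> = 4 * pi / 5"
    and h: "P = rhombus_at m a r" "norm a = 1" "norm r = 1" "Re r = cos \<theta>" by blast
  then consider "r = cis (1 * \<theta>)" | "r = cis (- 1 * \<theta>)" using cis_of_Re[OF h(3,4)] by auto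
  then obtain \<sigma> where \<sigma>: "\<sigma> = 1 \<or> \<sigma> = - 1" "r = cis (\<sigma> * \<theta>)" by metis
  have "r = cis (\<sigma> * pi / 10) ^ 4 \<or> r = cis (\<sigma> * pi / 10) ^ 8"
  proof -
    have "cis (\<sigma> * pi / 10) ^ 4 = cis (\<sigma> * (2 * pi / 5))" "cis (\<sigma> * pi / 10) ^ 8 = cis (\<sigma> * (4 * pi / 5))"
      by (simp_all add: Complex.DeMoivre ac_simps)
    with th show ?thesis unfolding \<sigma>(2) by metis
  qed
  then have "level_tile \<sigma> m a P"
    unfolding level_tile_def using h root_sum.zero by (intro exI[of _ m] exI[of _ a] exI[of _ r]) auto
  with that \<sigma>(1) h(2) show ?thesis by blast
qed

lemma level_tile_golden:
  assumes "level_tile s c u P" "s = 1 \<or> s = - 1" "norm u = 1"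
  shows "golden_tile P"
proof -
  obtain m a r where h: "P = rhombus_at m a r" "r = cis (s * pi / 10) ^ 4 \<or> r = cis (s * pi / 10) ^ 8"
     "(a / u) ^ 5 = 1" using assms(1) unfolding level_tile_def by blast
  have "norm a = 1" using norm_fifth_root[OF h(3)] assms(3) by (simp add: norm_divide)
  moreover have "r ^ 5 = 1"
    using h(2) assms(2) cis_multiple_2pi[of 1] cis_multiple_2pi[of 2] cis_multiple_2pi[of "-1"] cis_multiple_2pi[of "-2"]
    by (auto simp: Complex.DeMoivre)
  moreover have "r \<noteq> 1"
  proof -
    have "cos (2 * pi / 5) < cos 0" "cos (4 * pi / 5) < cos 0"
      by (intro cos_monotone_0_pi; simp)+
    moreover have "Re r = cos (2 * pi / 5) \<or> Re r = cos (4 * pi / 5)"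
      using h(2) assms(2) by (auto simp: Complex.DeMoivre)
    ultimately show ?thesis by auto
  qed
  ultimately show ?thesis unfolding golden_tile_def using h(1) by blast
qed

text \<open>
  The marks of the new tiles are inflated corners of the old ones, all of which have index 0 because
  \<open>infl = e * (1 - e ^ 8)\<close> and \<open>(- (e ^ 8)) ^ 5 = - 1\<close>.
\<close>

lemma level_tile_subst:
  assumes P: "level_tile s c u P" and s: "s = 1 \<or> s = - 1" and u: "norm u = 1" and P': "P' \<in> subst_tile P"
  shows "level_tile (- s) (of_real infl * c) (u * cis (s * pi / 10)) P'"
proof -
  define e l f where "e = cis (s * pi / 10)" and "l = complex_of_real infl" and "f = cis (- s * pi / 10)"
  obtain m a r where h: "P = rhombus_at m a r" "r = e ^ 4 \<or> r = e ^ 8"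
     "(a / u) ^ 5 = 1" "root_sum 0 ((m - c) / u)" using P unfolding level_tile_def e_def by blast
  have na: "norm a = 1" using norm_fifth_root[OF h(3)] u by (simp add: norm_divide)
  have u0: "u \<noteq> 0" and e0: "e \<noteq> 0" using u by (auto simp: e_def)
  have e10: "e ^ 10 = - 1" unfolding e_def by (rule cis_pow10[OF s])
  have e20: "e ^ 20 = 1" and e30: "e ^ 30 = - 1" and e40: "e ^ 40 = 1" using e10 by algebra+
  have "e * f = 1" by (simp add: e_def f_def cis_mult)
  then have f: "f = - (e ^ 9)" using e10 by algebra
  have l: "l = e - e ^ 9" using infl_eq[OF s] f by (simp add: l_def e_def f_def)
  have index: "root_sum 0 ((l * x - l * c) / (u * e))" if "root_sum k ((x - c) / u)" for k x
  proof -
    have "(- (e ^ 8)) ^ 5 = - 1" using e40 by (simp flip: power_mult)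
    from root_sum_scale[OF that this]
    have "root_sum 0 ((1 - e ^ 8) * ((x - c) / u))" by simp
    moreover have "(l * x - l * c) / (u * e) = (1 - e ^ 8) * ((x - c) / u)"
      unfolding l using u0 e0 by (simp add: field_simps power_numeral_reduce)
    ultimately show ?thesis by simp
  qed
  have r5: "r ^ 5 = 1" using h(2) e20 e40 by (auto simp flip: power_mult)
  have ru: "root_sum 1 (a / u)" "root_sum 1 (a * r / u)"
    using h(3) r5 by (auto intro!: root_sum_root simp: power_divide power_mult_distrib)
  have i1: "root_sum 1 ((m + a - c) / u)" "root_sum 1 ((m + a * r - c) / u)" "root_sum 2 ((m + a + a * r - c) / u)"
    using root_sum_plus[OF h(4) ru(1)] root_sum_plus[OF h(4) ru(2)]
      root_sum_plus[OF root_sum_plus[OF h(4) ru(1)] ru(2)]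
    by (simp_all add: add_divide_distrib diff_divide_distrib algebra_simps)
  have child: "level_tile (- s) (l * c) (u * e) (rhombus_at (l * x) (a * e * w) r')"
    if "root_sum k ((x - c) / u)" "w ^ 5 = 1" "r' = f ^ 4 \<or> r' = f ^ 8" for k x w r'
  proof -
    have "(a * e * w / (u * e)) ^ 5 = 1"
      using h(3) that(2) e0 by (simp add: power_divide power_mult_distrib)
    then show ?thesis unfolding level_tile_def f_def[symmetric] using index[OF that(1)] that(3) by blast
  qed
  have w: "(e ^ 8) ^ 5 = 1" "(e ^ 4) ^ 5 = 1" "(- (e ^ 2)) ^ 5 = 1" "(- (e ^ 6)) ^ 5 = 1" "1 ^ 5 = (1 :: complex)"
    using e10 e20 e30 e40 by (simp_all add: power_minus_odd flip: power_mult)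
  have sc: "scale_tile infl P = rhombus_at (l * m) (l * a) r"
    unfolding h(1) rhombus_at_def l_def by (simp add: scaleR_conv_of_real algebra_simps)
  have ne: "cos (2 * pi / 5) > 0" "cos (4 * pi / 5) < 0"
  proof -
    show "cos (2 * pi / 5) > 0" by (intro cos_gt_zero_pi) (auto simp: field_simps)
    have "cos (4 * pi / 5) < cos (pi / 2)" by (intro cos_monotone_0_pi) (auto simp: field_simps)
    then show "cos (4 * pi / 5) < 0" by simp
  qed
  have Re: "Re (e ^ 4) = cos (2 * pi / 5)" "Re (e ^ 8) = cos (4 * pi / 5)"
    using s by (auto simp: e_def Complex.DeMoivre)
  consider (thick) "thick P" | (thin) "\<not> thick P" "thin P"
    using P' unfolding subst_tile_def by (metis empty_iff)
  then have "level_tile (- s) (l * c) (u * e) P'"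
  proof cases
    case thick
    then have r: "r = e ^ 4" using thick_Re[of m a r] h(1,2) na Re ne by force
    have "P' \<in> subst_thick (rhombus_at (l * m) (l * a) (e ^ 4))"
      using P' thick sc unfolding subst_tile_def r by simp
    then show ?thesis
      unfolding subst_explicit(1)[OF na s, folded e_def l_def f_def]
      using child[OF h(4) w(2)] child[OF i1(1) w(1)] child[OF i1(2) w(5)] child[OF i1(3) w(3)]
      unfolding r by auto
  next
    case thin
    then have r: "r = e ^ 8" using thin_Re[of m a r] h(1,2) na Re ne by force
    have "P' \<in> subst_thin (rhombus_at (l * m) (l * a) (e ^ 8))"
      using P' thin sc unfolding subst_tile_def r by simp
    then show ?thesis
      unfolding subst_explicit(2)[OF na s, folded e_def l_def f_def]
      using child[OF h(4) w(1)] child[OF i1(2) w(5)] child[OF i1(3) w(4)]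
      unfolding r by auto
  qed
  then show ?thesis unfolding e_def l_def .
qed

lemma level_tile_iterate:
  assumes "thick P \<or> thin P"
  obtains s c u where "s = 1 \<or> s = - 1" "norm u = 1" "\<forall>P'\<in>(glb_subst ^^ k) {P}. level_tile s c u P'"
proof -
  have "\<exists>s c u. (s = 1 \<or> s = - 1) \<and> norm u = 1 \<and> (\<forall>P'\<in>(glb_subst ^^ k) {P}. level_tile s c u P')"
  proof (induction k)
    case 0
    show ?case using level_tile_start[OF assms] by (metis funpow_0 singletonD)
  next
    case (Suc k)
    then obtain s c u where h: "s = 1 \<or> s = - 1" "norm u = 1" "\<forall>P'\<in>(glb_subst ^^ k) {P}. level_tile s c u P'"
      by blast
    have "\<forall>P'\<in>(glb_subst ^^ Suc k) {P}. level_tile (- s) (of_real infl * c) (u * cis (s * pi / 10)) P'"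
      using level_tile_subst[OF _ h(1,2)] h(3) by (fastforce simp: glb_subst_def)
    moreover have "- s = 1 \<or> - s = - 1" "norm (u * cis (s * pi / 10)) = 1"
      using h(1,2) by (auto simp: norm_mult)
    ultimately show ?case by blast
  qed
  then show ?thesis using that by blast
qed

section \<open>Positions modulo five and the frieze pattern\<close>

lemma thick_or_thin_golden:
  assumes "thick P \<or> thin P"
  shows "golden_tile P"
  using level_tile_start[OF assms] level_tile_golden by metis

text \<open>
  In a tile of the tiling either black corner may be the one that the substitution has marked, whence the
  disjunction. The fifth power of an edge at a black corner is recorded because the origin and the unit
  change with the patch, whereas edges are unaffected by translations.
\<close>

fun indexed :: "complex \<Rightarrow> complex \<Rightarrow> dtile \<Rightarrow> bool" where
  "indexed c u (m, t, q, s) \<longleftrightarrow> root_sum 1 ((t - c) / u) \<and> root_sum 1 ((s - c) / u) \<and>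
     (root_sum 0 ((m - c) / u) \<and> root_sum 2 ((q - c) / u) \<and> (t - m) ^ 5 = u ^ 5 \<or>
      root_sum 2 ((m - c) / u) \<and> root_sum 0 ((q - c) / u) \<and> (t - m) ^ 5 = - (u ^ 5))"

lemma level_tile_indexed:
  assumes P: "level_tile s' c u (m, t, q, s)" and s': "s' = 1 \<or> s' = - 1" and u: "norm u = 1"
  shows "root_sum 0 ((m - c) / u)" "root_sum 1 ((t - c) / u)" "root_sum 2 ((q - c) / u)" "root_sum 1 ((s - c) / u)"
    and "(t - m) ^ 5 = u ^ 5" "(s - m) ^ 5 = u ^ 5" "t - m = q - s"
proof -
  obtain a r where h: "t = m + a" "q = m + a + a * r" "s = m + a * r" "(a / u) ^ 5 = 1"
      "root_sum 0 ((m - c) / u)"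
    using P unfolding level_tile_def rhombus_at_def by auto
  obtain m' a' r' where g: "(m, t, q, s) = rhombus_at m' a' r'" "norm a' = 1" "r' ^ 5 = 1"
    using level_tile_golden[OF P s' u] unfolding golden_tile_def by blast
  then have "a' = a" "a * r = a * r'" using h(1-3) by (auto simp: rhombus_at_def)
  then have r5: "r ^ 5 = 1" using g(2,3) by auto
  have u0: "u \<noteq> 0" using u by auto
  have a5: "a ^ 5 = u ^ 5" using h(4) u0 by (simp add: power_divide)
  have i: "root_sum 1 (a / u)" "root_sum 1 (a * r / u)"
    using h(4) r5 by (auto intro!: root_sum_root simp: power_divide power_mult_distrib)
  show "root_sum 0 ((m - c) / u)" by (rule h)
  show "root_sum 1 ((t - c) / u)" "root_sum 2 ((q - c) / u)" "root_sum 1 ((s - c) / u)"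
    using root_sum_plus[OF h(5) i(1)] root_sum_plus[OF h(5) i(2)]
      root_sum_plus[OF root_sum_plus[OF h(5) i(1)] i(2)] unfolding h(1-3)
    by (simp_all add: add_divide_distrib diff_divide_distrib algebra_simps)
  show "(t - m) ^ 5 = u ^ 5" "(s - m) ^ 5 = u ^ 5" "t - m = q - s"
    using h(1-3) a5 r5 by (simp_all add: power_mult_distrib)
qed

lemma uminus_pow5: "(- x) ^ 5 = - (x ^ 5 :: complex)"
  by simp

text \<open>
  The decorations of the two tiles can differ in the order of the black corners and in that of the white
  ones. Exchanging the black corners reverses the edges that leave \<open>m\<close>, whence the sign.
\<close>

lemma level_tile_region_indexed:
  assumes P: "level_tile s' c u P" and s': "s' = 1 \<or> s' = - 1" and u: "norm u = 1"
    and Q: "golden_tile (m, t, q, s)" and R: "region (m, t, q, s) = region P"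
  shows "indexed c u (m, t, q, s)"
proof -
  obtain m' t' q' s0 where P': "P = (m', t', q', s0)" by (metis prod_cases4)
  note l = level_tile_indexed[OF P[unfolded P'] s' u]
  note e = golden_tile_region_eq[OF Q level_tile_golden[OF P s' u, unfolded P'] R[unfolded P']]
  have "t' - q' = - (s0 - m')" "s0 - q' = - (t' - m')" using l(7) by (auto simp: algebra_simps)
  then have "(t' - q') ^ 5 = - (u ^ 5)" "(s0 - q') ^ 5 = - (u ^ 5)"
    by (simp_all only: uminus_pow5 l(5,6))
  note f = this
  from e(1) show ?thesis
  proof
    assume "m = m' \<and> q = q'"
    then show ?thesis using e(2) l(1-6) by (elim disjE conjE) simp_all
  next
    assume "m = q' \<and> q = m'"
    then show ?thesis using e(2) l(1-4) f by (elim disjE conjE) simp_all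
  qed
qed

text \<open>
  The two tiles form a finite patch, so some translate of both lies in one \<open>\<sigma>\<^sup>k(P)\<close>. The translation is
  absorbed by the origin.
\<close>

lemma glb_tiling_pair_indexed:
  assumes T: "glb_tiling \<T>"
    and "golden_tile (m, t, q, s)" "region (m, t, q, s) \<in> \<T>"
    and "golden_tile (m', t', q', s')" "region (m', t', q', s') \<in> \<T>"
  obtains c u where "indexed c u (m, t, q, s)" "indexed c u (m', t', q', s')"
proof -
  let ?Q = "{region (m, t, q, s), region (m', t', q', s')}"
  obtain P where P: "thick P \<or> thin P" and fp: "\<forall>\<Q>. \<Q> \<subseteq> \<T> \<and> finite \<Q> \<longrightarrow>
           (\<exists>k\<ge>1. \<exists>z. (\<lambda>R. (+) z ` R) ` \<Q> \<subseteq> region ` (glb_subst ^^ k) {P})"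
    using T unfolding glb_tiling_def by blast
  have "\<exists>k\<ge>1. \<exists>z. (\<lambda>R. (+) z ` R) ` ?Q \<subseteq> region ` (glb_subst ^^ k) {P}"
    using assms by (intro fp[rule_format]) simp
  then obtain k z where kz: "(\<lambda>R. (+) z ` R) ` ?Q \<subseteq> region ` (glb_subst ^^ k) {P}" by blast
  obtain \<sigma> c u where l: "\<sigma> = 1 \<or> \<sigma> = - 1" "norm u = 1" "\<forall>P'\<in>(glb_subst ^^ k) {P}. level_tile \<sigma> c u P'"
    by (rule level_tile_iterate[OF P])
  have "indexed (c - z) u (m, t, q, s)"
    if g: "golden_tile (m, t, q, s)" and R: "region (m, t, q, s) \<in> ?Q" for m t q s
  proof -
    have "(+) z ` region (m, t, q, s) \<in> region ` (glb_subst ^^ k) {P}"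
      using kz imageI[OF R, of "\<lambda>R. (+) z ` R"] by (rule subsetD)
    then obtain P' where P': "P' \<in> (glb_subst ^^ k) {P}" "(+) z ` region (m, t, q, s) = region P'"
      by (rule imageE) metis
    have "indexed c u (z + m, z + t, z + q, z + s)"
      using l(3) P' golden_tile_translate[OF g]
      by (intro level_tile_region_indexed[OF _ l(1,2), of c P']) simp_all
    moreover have "x - (c - z) = z + x - c" for x by simp
    ultimately show ?thesis by (simp only: indexed.simps add_diff_cancel_left)
  qed
  then show ?thesis using that assms by blast
qed

text \<open>
  Flipping a tile turns \<open>q\<close> into \<open>m\<close> and \<open>s\<close> into \<open>t\<close>, so it is enough to consider these corners here
  and in the next lemma.
\<close>

lemma glb_tiling_black_white:
  assumes T: "glb_tiling \<T>"
    and P: "golden_tile (m, t, q, s)" "region (m, t, q, s) \<in> \<T>"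
    and P': "golden_tile (m', t', q', s')" "region (m', t', q', s') \<in> \<T>"
  shows "m \<noteq> t'"
proof
  assume m: "m = t'"
  obtain c u where i: "indexed c u (m, t, q, s)" "indexed c u (m', t', q', s')"
    using glb_tiling_pair_indexed[OF T P P'] by metis
  then have "root_sum 1 ((m - c) / u)" "root_sum 0 ((m - c) / u) \<or> root_sum 2 ((m - c) / u)" using m by auto
  then show False using root_sum_unique[of 1 _ 0] root_sum_unique[of 1 _ 2] by auto
qed

lemma glb_tiling_same_black:
  assumes T: "glb_tiling \<T>"
    and P: "golden_tile (m, t, q, s)" "region (m, t, q, s) \<in> \<T>"
    and P': "golden_tile (m, t', q', s')" "region (m, t', q', s') \<in> \<T>"
  shows "(t - m) ^ 5 = (t' - m) ^ 5"
proof -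
  obtain c u where i: "indexed c u (m, t, q, s)" "indexed c u (m, t', q', s')"
    using glb_tiling_pair_indexed[OF T P P'] by metis
  have "\<not> (root_sum 0 ((m - c) / u) \<and> root_sum 2 ((m - c) / u))"
    using root_sum_unique[of 0 _ 2] by auto
  then show ?thesis using i by auto
qed

lemma glb_tiling_edge_classes:
  assumes T: "glb_tiling \<T>"
    and P: "golden_tile (m, t, q, s)" "region (m, t, q, s) \<in> \<T>"
    and P': "golden_tile (m', t', q', s')" "region (m', t', q', s') \<in> \<T>"
  shows "(t - m) ^ 5 = (t' - m') ^ 5 \<or> (t - m) ^ 5 = - ((t' - m') ^ 5)"
proof -
  obtain c u where "indexed c u (m, t, q, s)" "indexed c u (m', t', q', s')"
    using glb_tiling_pair_indexed[OF T P P'] by metis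
  then show ?thesis by auto
qed

theorem theorem3p1:
  fixes \<T> :: "complex set set"
  assumes "glb_tiling \<T>"
  shows "\<exists>f :: complex \<Rightarrow> int. frieze_pattern \<T> f \<and> card (f ` tiling_vertices \<T>) = 3"
proof -
  define tile where "tile m t q s \<longleftrightarrow> golden_tile (m, t, q, s) \<and> region (m, t, q, s) \<in> \<T>" for m t q s
  have flip: "tile q s m t" "tile m s q t" if "tile m t q s" for m t q s
    using that golden_tile_flip[of m t q s]
    unfolding tile_def region_flip(1)[of q s m t] region_flip(2)[of m s q t] by blast+
  have rt: "rhombus_tiling \<T>" using assms by (simp only: glb_tiling_def)
  have tiles: "\<exists>m t q s. tile m t q s \<and> R = region (m, t, q, s)" if "R \<in> \<T>" for R
  proof -
    have "\<exists>P. (thick P \<or> thin P) \<and> R = region P"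
      using rt[unfolded rhombus_tiling_def, THEN conjunct1] that by (rule bspec)
    then obtain P where P: "thick P \<or> thin P" "R = region P" by (elim exE conjE)
    obtain m t q s where "P = (m, t, q, s)" by (rule prod_cases4)
    with thick_or_thin_golden[OF P(1)] P(2) that have "tile m t q s \<and> R = region (m, t, q, s)"
      unfolding tile_def by (simp only: simp_thms)
    then show ?thesis by blast
  qed
  have "\<Union>\<T> = UNIV" using rt by (simp only: rhombus_tiling_def)
  then obtain R where "R \<in> \<T>" by (metis UnionE UNIV_I)
  then obtain m0 t0 q0 s0 where t0: "tile m0 t0 q0 s0" using tiles by meson
  \<comment> \<open>black vertices are split by the fifth power of their edges, relative to one fixed tile\<close>
  define f :: "complex \<Rightarrow> int" where "f v =
    (if \<exists>m q s. tile m v q s then 2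
     else if \<exists>t q s. tile v t q s \<and> (t - v) ^ 5 = (t0 - m0) ^ 5 then 1 else 3)" for v
  have white: "f t = 2" if "tile m t q s" for m t q s using that unfolding f_def by auto
  have black: "f m = (if (t - m) ^ 5 = (t0 - m0) ^ 5 then 1 else 3)" if "tile m t q s" for m t q s
  proof -
    have "\<not> (\<exists>m' q' s'. tile m' m q' s')"
      using glb_tiling_black_white[OF assms] that unfolding tile_def by blast
    moreover have "(\<exists>t q s. tile m t q s \<and> (t - m) ^ 5 = (t0 - m0) ^ 5) \<longleftrightarrow> (t - m) ^ 5 = (t0 - m0) ^ 5"
      using glb_tiling_same_black[OF assms] that unfolding tile_def by metis
    ultimately show ?thesis unfolding f_def by simp
  qed
  have "t0 \<noteq> m0" using golden_tile_corners(3) t0 unfolding tile_def by blast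
  then have U0: "(t0 - m0) ^ 5 \<noteq> 0" by simp
  have tile_values: "f t = 2 \<and> f s = 2 \<and> {f m, f q} = {1, 3}" if "tile m t q s" for m t q s
  proof -
    \<comment> \<open>the edges at the opposite black corner have the opposite fifth power\<close>
    have "s - q = - (t - m)" using that unfolding tile_def golden_tile_def by (auto simp: rhombus_at_def)
    then have "(s - q) ^ 5 = - ((t - m) ^ 5)" by (simp only: uminus_pow5)
    moreover have "(t - m) ^ 5 = (t0 - m0) ^ 5 \<or> (t - m) ^ 5 = - ((t0 - m0) ^ 5)"
      using glb_tiling_edge_classes[OF assms] that t0 unfolding tile_def by blast
    ultimately have "{f m, f q} = {1, 3}"
      using black[OF that] black[OF flip(1)[OF that]] U0 by auto
    then show ?thesis using white[OF that] white[OF flip(2)[OF that]] by blast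
  qed
  have frieze: "frieze_pattern \<T> f"
    unfolding frieze_pattern_def
  proof (intro conjI ballI allI impI)
    show "f v > 0" for v unfolding f_def by simp
    fix m t q s
    assume "(thick (m, t, q, s) \<or> thin (m, t, q, s)) \<and> region (m, t, q, s) \<in> \<T>"
    then have "tile m t q s" using thick_or_thin_golden unfolding tile_def by blast
    from tile_values[OF this] show "f t * f s - f m * f q = 1" by (auto simp: doubleton_eq_iff)
  qed
  have "f ` tiling_vertices \<T> = {1, 2, 3}"
  proof
    show "f ` tiling_vertices \<T> \<subseteq> {1, 2, 3}" unfolding f_def by auto
    have "{m0, t0, q0, s0} \<subseteq> tiling_vertices \<T>"
      using golden_tile_corners(1) t0 unfolding tile_def tiling_vertices_def by blast
    moreover have "{1, 2, 3} \<subseteq> f ` {m0, t0, q0, s0}" using tile_values[OF t0] by (auto simp: doubleton_eq_iff)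
    ultimately show "{1, 2, 3} \<subseteq> f ` tiling_vertices \<T>" by blast
  qed
  then have "card (f ` tiling_vertices \<T>) = 3" by simp
  with frieze show ?thesis by blast
qed

end
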